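(* Let $S_+^k \subset \mathbb{R}^n$ be the (nonempty, finite) set of positive training examples in the $k$-th cluster and let $S_-^k \subset \mathbb{R}^n$ be the (finite) set of training examples not in the $k$-th cluster. Fix a coordinate $j \in \{1,\dots,n\}$, a weight $0<c<1$ and a regularization parameter $\beta \in \mathbb{R}$. For $p=1,\dots,n$ let $l_{s,p,k} = \min_{x \in S_+^k} x_p$ and $u_{s,p,k} = \max_{x\in S_+^k} x_p$. With $X_{l,j,k} \subseteq \mathbb{R}^n$ as defined in the context, put $$R_+^{l,j,k} := \sum_{x \in S_+^k \cap X_{l,j,k}} \exp\left[-(x_j - l_{s,j,k} + 1)\right],$$ $$R_-^{l,j,k} := \sum_{x \in S_-^k \cap X_{l,j,k}} \exp\Big[x_j - l_{s,j,k} + 1 + \sum_{p \neq j}\big(\lfloor x_p - u_{s,p,k}\rfloor_+ + \lfloor l_{s,p,k} - x_p\rfloor_+\big)\Big].$$ If $R_-^{l,j,k} > 0$, then the solution of the problem of minimizing, over $l_{r,j,k} \in \mathbb{R}$, the function $$R_+^{l,j,k}\exp(-l_{s,j,k} + 1 + l_{r,j,k}) + c\,R_-^{l,j,k}\exp(l_{s,j,k} - 1 - l_{r,j,k}) + \beta\, l_{r,j,k}$$ is $$l_{r,j,k} = l_{s,j,k} - 1 + \log\left(\frac{-\beta + \sqrt{\beta^2 + 4c R_+^{l,j,k} R_-^{l,j,k}}}{2R_+^{l,j,k}}\right).$$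
   Context: Notation: $\lfloor t \rfloor_+ = \max(t,0)$ for $t\in\mathbb{R}$, and $x_p$ is the $p$-th coordinate of $x \in \mathbb{R}^n$. The numbers $l_{s,p,k}$ and $u_{s,p,k}$ are the boundaries of the smallest axis-parallel box enclosing the $k$-th cluster of positive examples. The set of points used to adjust the lower boundary in dimension $j$ of the $k$-th box is $$X_{l,j,k} := \{x \in \mathbb{R}^n : x_j \leq l_{s,j,k}\} \cup \Big\{x \in \mathbb{R}^n : l_{s,j,k} \leq x_j \leq \tfrac{l_{s,j,k}+u_{s,j,k}}{2},\ l_{s,p,k} \leq x_p \leq u_{s,p,k} \text{ for all } p \neq j\Big\}.$$ The parameter $c$ is the weight given to the majority class. *)

theory Defs
  imports "HOL-Analysis.Analysis"
begin

definition pos_part :: "real \<Rightarrow> real" where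
  "pos_part t = max t 0"

definition box_lower :: "(real ^ 'n) set \<Rightarrow> 'n \<Rightarrow> real" where
  "box_lower P p = Min ((\<lambda>x. x $ p) ` P)"

definition box_upper :: "(real ^ 'n) set \<Rightarrow> 'n \<Rightarrow> real" where
  "box_upper P p = Max ((\<lambda>x. x $ p) ` P)"

text \<open>Throughout, \<open>P\<close> is the cluster of positive examples, \<open>N\<close> the set of training examples
  outside it, and \<open>j\<close> the coordinate whose lower boundary is adjusted.\<close>

definition adjust_region :: "(real ^ 'n) set \<Rightarrow> 'n \<Rightarrow> (real ^ 'n) set" where
  "adjust_region P j =
     {x. x $ j \<le> box_lower P j} \<union>
     {x. box_lower P j \<le> x $ j \<and> x $ j \<le> (box_lower P j + box_upper P j) / 2 \<and>
         (\<forall>p. p \<noteq> j \<longrightarrow> box_lower P p \<le> x $ p \<and> x $ p \<le> box_upper P p)}"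

definition R_plus :: "(real ^ 'n) set \<Rightarrow> 'n \<Rightarrow> real" where
  "R_plus P j = (\<Sum>x \<in> P \<inter> adjust_region P j. exp (- (x $ j - box_lower P j + 1)))"

definition R_minus :: "(real ^ 'n) set \<Rightarrow> (real ^ 'n) set \<Rightarrow> 'n \<Rightarrow> real" where
  "R_minus P N j =
     (\<Sum>x \<in> N \<inter> adjust_region P j.
        exp (x $ j - box_lower P j + 1 +
             (\<Sum>p \<in> UNIV - {j}. pos_part (x $ p - box_upper P p) + pos_part (box_lower P p - x $ p))))"

definition lower_objective ::
  "(real ^ 'n) set \<Rightarrow> (real ^ 'n) set \<Rightarrow> 'n \<Rightarrow> real \<Rightarrow> real \<Rightarrow> real \<Rightarrow> real" where
  "lower_objective P N j c \<beta> l =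
     R_plus P j * exp (- box_lower P j + 1 + l)
     + c * R_minus P N j * exp (box_lower P j - 1 - l) + \<beta> * l"

end

theory Submission
  imports Defs
begin

text \<open>In the variable \<open>t = l - box_lower P j + 1\<close> the objective is, up to a constant,
  \<open>A * exp t + B * exp (- t) + \<beta> * t\<close> with \<open>A, B > 0\<close>. Let \<open>w\<close> be the positive root of
  \<open>A * w\<^sup>2 + \<beta> * w - B\<close>. Substituting \<open>\<beta> = B / w - A * w\<close>, the excess over the value at \<open>ln w\<close>
  becomes \<open>A * w * (exp d - 1 - d) + B / w * (exp (- d) - 1 + d)\<close> with \<open>d = t - ln w\<close>,
  which is positive unless \<open>d = 0\<close>.\<close>

text \<open>Equality would give \<open>ln y = y - 1\<close> at \<open>y = exp x\<close>, which
  forces \<open>y = 1\<close> and so \<open>x = 0\<close>.\<close>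

lemma exp_gt_add_one_self:
  fixes x :: real
  assumes "x \<noteq> 0"
  shows "1 + x < exp x"
proof -
  have "exp x \<noteq> 1 + x"
    using assms ln_eq_minus_one[of "exp x"] by auto
  then show ?thesis
    using exp_ge_add_one_self[of x] by linarith
qed

text \<open>Solving the root equation for \<open>\<beta>\<close> rids the later estimate of the
  square root.\<close>

lemma quadratic_pos_root:
  fixes A B \<beta> :: real
  assumes "A > 0" and "B > 0"
  defines "w \<equiv> (- \<beta> + sqrt (\<beta>\<^sup>2 + 4 * A * B)) / (2 * A)"
  shows "w > 0" and "\<beta> = B / w - A * w"
proof -
  define D where "D = sqrt (\<beta>\<^sup>2 + 4 * A * B)"
  have AB: "A * B > 0"
    using assms(1,2) by simp
  \<comment> \<open>The left side is the square root of \<open>\<beta>\<^sup>2\<close>, and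
    \<open>4 * A * B\<close> is positive.\<close>
  have "\<bar>\<beta>\<bar> < D"
    using AB real_sqrt_less_mono[of "\<beta>\<^sup>2" "\<beta>\<^sup>2 + 4 * A * B"] by (simp add: D_def)
  then show w: "w > 0"
    using assms(1) by (simp add: w_def D_def)
  have D: "D = 2 * A * w + \<beta>"
    using assms(1) by (simp add: w_def D_def)
  have "D\<^sup>2 = \<beta>\<^sup>2 + 4 * A * B"
    using AB by (simp add: D_def)
  \<comment> \<open>Completing the square, read backwards: \<open>\<beta>\<^sup>2\<close>
    cancels.\<close>
  then have "4 * A * (A * w\<^sup>2 + \<beta> * w - B) = 0"
    unfolding D by (simp add: power2_eq_square algebra_simps)
  then have "A * w\<^sup>2 + \<beta> * w = B"
    using assms(1) by simp
  then show "\<beta> = B / w - A * w"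
    using w by (simp add: field_simps power2_eq_square)
qed

lemma exp_objective_gt:
  fixes A B \<beta> t :: real
  assumes "A > 0" and "B > 0"
  defines "w \<equiv> (- \<beta> + sqrt (\<beta>\<^sup>2 + 4 * A * B)) / (2 * A)"
  assumes "t \<noteq> ln w"
  shows "A * exp (ln w) + B * exp (- ln w) + \<beta> * ln w < A * exp t + B * exp (- t) + \<beta> * t"
proof -
  have w: "w > 0" and b: "\<beta> = B / w - A * w"
    using quadratic_pos_root[OF assms(1,2), of \<beta>] by (simp_all add: w_def)
  define d where "d = t - ln w"
  have d: "d \<noteq> 0" and t: "t = ln w + d"
    using assms(4) by (simp_all add: d_def)
  have e: "exp (- ln w) = 1 / w" "exp t = w * exp d" "exp (- t) = exp (- d) / w"
    using w by (simp_all add: t exp_add exp_diff exp_minus field_simps)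
  have "0 < A * w * (exp d - 1 - d)"
    using exp_gt_add_one_self[OF d] assms(1) w by simp
  moreover have "0 < B / w * (exp (- d) - 1 + d)"
    using exp_gt_add_one_self[of "- d"] d assms(2) w by simp
  moreover have "A * exp t + B * exp (- t) + \<beta> * t - (A * exp (ln w) + B * exp (- ln w) + \<beta> * ln w)
      = A * w * (exp d - 1 - d) + B / w * (exp (- d) - 1 + d)"
    using w by (simp add: e b d_def algebra_simps)
  ultimately show ?thesis
    by linarith
qed

text \<open>A point of \<open>P\<close> attaining the minimal \<open>j\<close>-th coordinate
  satisfies \<open>x $ j \<le> box_lower P j\<close>, so the sum of exponentials has at least one
  term.\<close>

lemma R_plus_pos:
  fixes P :: "(real ^ 'n) set"
  assumes "finite P" and "P \<noteq> {}"
  shows "R_plus P j > 0"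
proof -
  have "box_lower P j \<in> (\<lambda>x. x $ j) ` P"
    unfolding box_lower_def using assms by (intro Min_in) auto
  then obtain x where "x \<in> P" "x $ j = box_lower P j"
    by auto
  then have "P \<inter> adjust_region P j \<noteq> {}"
    by (auto simp: adjust_region_def)
  then show ?thesis
    unfolding R_plus_def using assms(1) by (intro sum_pos) auto
qed

lemma is_arg_min_unique:
  fixes f :: "'a \<Rightarrow> 'b :: order"
  assumes "\<And>y. y \<noteq> x \<Longrightarrow> f x < f y"
  shows "is_arg_min f (\<lambda>_. True) y \<longleftrightarrow> y = x"
  using assms by (metis is_arg_min_def less_asym)

theorem proposition1:
  fixes P N :: "(real ^ 'n) set" and j :: 'n and c \<beta> :: real
  assumes "finite P" and "P \<noteq> {}" and "finite N"
    and "0 < c" and "c < 1"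
    and "R_minus P N j > 0"
  shows "\<forall>l. is_arg_min (lower_objective P N j c \<beta>) (\<lambda>_. True) l \<longleftrightarrow>
           l = box_lower P j - 1 +
               ln ((- \<beta> + sqrt (\<beta>\<^sup>2 + 4 * c * R_plus P j * R_minus P N j)) / (2 * R_plus P j))"
proof (intro allI is_arg_min_unique)
  define s where "s = box_lower P j"
  define A where "A = R_plus P j"
  define B where "B = c * R_minus P N j"
  define w where "w = (- \<beta> + sqrt (\<beta>\<^sup>2 + 4 * A * B)) / (2 * A)"
  have pos: "A > 0" "B > 0"
    using R_plus_pos[OF assms(1,2)] assms(4,6) by (simp_all add: A_def B_def)
  have w: "(- \<beta> + sqrt (\<beta>\<^sup>2 + 4 * c * R_plus P j * R_minus P N j)) / (2 * R_plus P j) = w"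
    by (simp add: w_def A_def B_def mult_ac)
  \<comment> \<open>The shift by \<open>s - 1\<close> makes the exponents \<open>t\<close> and
    \<open>- t\<close>; the constant it leaves behind cancels when two values are compared.\<close>
  have obj: "lower_objective P N j c \<beta> (s - 1 + t)
      = A * exp t + B * exp (- t) + \<beta> * t + \<beta> * (s - 1)" for t
    by (simp add: lower_objective_def s_def A_def B_def algebra_simps)
  fix y
  assume "y \<noteq> box_lower P j - 1 +
    ln ((- \<beta> + sqrt (\<beta>\<^sup>2 + 4 * c * R_plus P j * R_minus P N j)) / (2 * R_plus P j))"
  then have "y - (s - 1) \<noteq> ln w"
    unfolding w s_def by auto
  then have "lower_objective P N j c \<beta> (s - 1 + ln w)
      < lower_objective P N j c \<beta> (s - 1 + (y - (s - 1)))"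
    unfolding obj using exp_objective_gt[OF pos, of "y - (s - 1)" \<beta>] by (simp add: w_def)
  then show "lower_objective P N j c \<beta> (box_lower P j - 1 +
      ln ((- \<beta> + sqrt (\<beta>\<^sup>2 + 4 * c * R_plus P j * R_minus P N j)) / (2 * R_plus P j)))
    < lower_objective P N j c \<beta> y"
    unfolding w s_def by simp
qed

end
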